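(* Let $S$ be an invariant surface in Sol. Then $S$ is minimal (mean curvature $H\equiv 0$) if and only if it is (an open part of) one of the following surfaces: (1) a leaf $Q_t=\{(x,t,z):x,z\in\mathbb{R}\}$, $t\in\mathbb{R}$, of the foliation $\mathcal{F}_2$; or (2) a leaf $R_t=\{(x,y,t):x,y\in\mathbb{R}\}$, $t\in\mathbb{R}$, of the foliation $\mathcal{F}_3$; or (3) up to integration constants, the surface generated by the graph $z(y)=\log(y)$, that is, a surface whose generating curve is a graph $z(y)=\log(ay+b)$ with constants $a\neq 0$ and $b\in\mathbb{R}$.
   Context: Sol is $\mathbb{R}^3$ with the Riemannian metric $e^{2z}dx^2+e^{-2z}dy^2+dz^2$. An orthonormal frame is $E_1=e^{-z}\partial_x$, $E_2=e^{z}\partial_y$, $E_3=\partial_z$. An invariant surface is a surface invariant under the one-parameter group of isometries $T_{1,c}(x,y,z)=(x+c,y,z)$, $c\in\mathbb{R}$. It is parametrized by $X(s,t)=(t,y(s),z(s))$, $s\in I$ (an open interval), $t\in\mathbb{R}$, where $\alpha(s)=(0,y(s),z(s))$ is the generating curve, parametrized by arc length: $y'=e^{z}\cos\theta$, $z'=\sin\theta$ for a smooth angle function $\theta=\theta(s)$. The surface is oriented by $N=-\sin\theta\,E_2+\cos\theta\,E_3$, and $H$ is the average of the two principal curvatures. The surface "generated by the graph $z=z(y)$" is $\{(t,y,z(y))\}$, i.e. its generating curve is the curve $\{(0,y,z(y))\}$. The foliations $\mathcal{F}_2=\{Q_t\}_{t\in\mathbb{R}}$ and $\mathcal{F}_3=\{R_t\}_{t\in\mathbb{R}}$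 consist of the leaves named in the claim. *)

theory Defs
  imports "HOL-Analysis.Analysis"
begin

section \<open>Riemannian metrics on coordinate space\<close>

text \<open>A metric on \<open>\<real>\<^sup>n\<close> is given by its coefficient matrix \<open>g p\<close> at each point \<open>p\<close>. All notions
  below are total functions, meaningful when \<open>g p\<close> is symmetric positive definite and \<open>g\<close> is
  differentiable.\<close>

definition metric_inner :: "(real^'n \<Rightarrow> real^'n^'n) \<Rightarrow> real^'n \<Rightarrow> real^'n \<Rightarrow> real^'n \<Rightarrow> real" where
  "metric_inner g p u v = u \<bullet> (g p *v v)"

definition coord_deriv :: "'n \<Rightarrow> (real^'n \<Rightarrow> real) \<Rightarrow> real^'n \<Rightarrow> real" where
  "coord_deriv i f p = deriv (\<lambda>h. f (p + h *\<^sub>R axis i 1)) 0"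

text \<open>Christoffel symbols of the Levi-Civita connection; \<open>christoffel g p k i j\<close> has upper index \<open>k\<close>.\<close>

definition christoffel :: "(real^'n \<Rightarrow> real^'n^'n) \<Rightarrow> real^'n \<Rightarrow> 'n \<Rightarrow> 'n \<Rightarrow> 'n \<Rightarrow> real" where
  "christoffel g p k i j =
     (1/2) * (\<Sum>l\<in>UNIV. matrix_inv (g p) $ k $ l *
        (coord_deriv i (\<lambda>q. g q $ j $ l) p + coord_deriv j (\<lambda>q. g q $ i $ l) p
          - coord_deriv l (\<lambda>q. g q $ i $ j) p))"

text \<open>Covariant derivative at \<open>u\<close> of a vector field \<open>V\<close> along a curve \<open>c\<close>.\<close>

definition cov_deriv ::
  "(real^'n \<Rightarrow> real^'n^'n) \<Rightarrow> (real \<Rightarrow> real^'n) \<Rightarrow> (real \<Rightarrow> real^'n) \<Rightarrow> real \<Rightarrow> real^'n" where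
  "cov_deriv g c V u =
     vector_derivative V (at u) +
     (\<chi> k. \<Sum>i\<in>UNIV. \<Sum>j\<in>UNIV.
        christoffel g (c u) k i j * vector_derivative c (at u) $ i * V u $ j)"

section \<open>Principal curvatures and mean curvature of a parametrized surface\<close>

text \<open>\<open>X s t\<close> is a parametrized surface in a three-dimensional Riemannian manifold and \<open>N s t\<close> a
  unit normal field along it. The principal curvatures are the eigenvalues of the shape operator
  \<open>v \<mapsto> - \<nabla>\<^sub>v N\<close>, where the nonzero tangent vector is written \<open>v = a X\<^sub>s + b X\<^sub>t\<close>.\<close>

definition principal_curvatures ::
  "(real^3 \<Rightarrow> real^3^3) \<Rightarrow> (real \<Rightarrow> real \<Rightarrow> real^3) \<Rightarrow> (real \<Rightarrow> real \<Rightarrow> real^3) \<Rightarrow> real \<Rightarrow> real \<Rightarrow> real set" where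
  "principal_curvatures g X N s t =
     {\<kappa>. \<exists>a b. (a, b) \<noteq> (0, 0) \<and>
        - (a *\<^sub>R cov_deriv g (\<lambda>u. X u t) (\<lambda>u. N u t) s + b *\<^sub>R cov_deriv g (X s) (N s) t)
        = \<kappa> *\<^sub>R (a *\<^sub>R vector_derivative (\<lambda>u. X u t) (at s) + b *\<^sub>R vector_derivative (X s) (at t))}"

text \<open>The shape operator is self-adjoint, so there are one (umbilic point) or two real eigenvalues,
  and the average of the two principal curvatures counted with multiplicity is the average of
  the largest and the smallest one.\<close>

definition mean_curvature ::
  "(real^3 \<Rightarrow> real^3^3) \<Rightarrow> (real \<Rightarrow> real \<Rightarrow> real^3) \<Rightarrow> (real \<Rightarrow> real \<Rightarrow> real^3) \<Rightarrow> real \<Rightarrow> real \<Rightarrow> real" where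
  "mean_curvature g X N s t =
     (Max (principal_curvatures g X N s t) + Min (principal_curvatures g X N s t)) / 2"

section \<open>The space Sol\<close>

definition sol_metric :: "real^3 \<Rightarrow> real^3^3" where
  "sol_metric p = vector [vector [exp (2 * p$3), 0, 0],
                          vector [0, exp (- 2 * p$3), 0],
                          vector [0, 0, 1]]"

definition sol_E1 :: "real^3 \<Rightarrow> real^3" where
  "sol_E1 p = vector [exp (- p$3), 0, 0]"

definition sol_E2 :: "real^3 \<Rightarrow> real^3" where
  "sol_E2 p = vector [0, exp (p$3), 0]"

definition sol_E3 :: "real^3 \<Rightarrow> real^3" where
  "sol_E3 p = vector [0, 0, 1]"

lemma sol_frame_orthonormal:
  "metric_inner sol_metric p (sol_E1 p) (sol_E1 p) = 1"
  "metric_inner sol_metric p (sol_E2 p) (sol_E2 p) = 1"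
  "metric_inner sol_metric p (sol_E3 p) (sol_E3 p) = 1"
  "metric_inner sol_metric p (sol_E1 p) (sol_E2 p) = 0"
  "metric_inner sol_metric p (sol_E1 p) (sol_E3 p) = 0"
  "metric_inner sol_metric p (sol_E2 p) (sol_E3 p) = 0"
  by (simp_all add: metric_inner_def sol_metric_def sol_E1_def sol_E2_def sol_E3_def inner_vec_def
      matrix_vector_mult_def sum_3 flip: exp_add)

definition sol_translation :: "real \<Rightarrow> real^3 \<Rightarrow> real^3" where
  "sol_translation c p = vector [p$1 + c, p$2, p$3]"

section \<open>Invariant surfaces\<close>

definition smooth_on_open :: "real set \<Rightarrow> (real \<Rightarrow> real) \<Rightarrow> bool" where
  "smooth_on_open I f \<longleftrightarrow> (\<forall>n. \<forall>s\<in>I. (deriv ^^ n) f differentiable (at s))"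

text \<open>Arc-length parametrized generating curve \<open>s \<mapsto> (0, y s, z s)\<close>, with angle function \<open>\<theta>\<close>, on a
  nonempty open interval \<open>I\<close>, possibly unbounded. The curve need not be injective.\<close>

definition generating_curve ::
  "real set \<Rightarrow> (real \<Rightarrow> real) \<Rightarrow> (real \<Rightarrow> real) \<Rightarrow> (real \<Rightarrow> real) \<Rightarrow> bool" where
  "generating_curve I y z \<theta> \<longleftrightarrow>
     open I \<and> is_interval I \<and> I \<noteq> {} \<and>
     smooth_on_open I y \<and> smooth_on_open I z \<and> smooth_on_open I \<theta> \<and>
     (\<forall>s\<in>I. (y has_real_derivative exp (z s) * cos (\<theta> s)) (at s)) \<and>
     (\<forall>s\<in>I. (z has_real_derivative sin (\<theta> s)) (at s))"

definition inv_param :: "(real \<Rightarrow> real) \<Rightarrow> (real \<Rightarrow> real) \<Rightarrow> real \<Rightarrow> real \<Rightarrow> real^3" where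
  "inv_param y z s t = vector [t, y s, z s]"

definition inv_normal ::
  "(real \<Rightarrow> real) \<Rightarrow> (real \<Rightarrow> real) \<Rightarrow> (real \<Rightarrow> real) \<Rightarrow> real \<Rightarrow> real \<Rightarrow> real^3" where
  "inv_normal y z \<theta> s t =
     - sin (\<theta> s) *\<^sub>R sol_E2 (inv_param y z s t) + cos (\<theta> s) *\<^sub>R sol_E3 (inv_param y z s t)"

definition inv_surface :: "real set \<Rightarrow> (real \<Rightarrow> real) \<Rightarrow> (real \<Rightarrow> real) \<Rightarrow> (real^3) set" where
  "inv_surface I y z = {inv_param y z s t | s t. s \<in> I}"

lemma inv_surface_invariant: "sol_translation c ` inv_surface I y z = inv_surface I y z"
proof -
  have S: "inv_surface I y z = (\<Union>s\<in>I. range (inv_param y z s))"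
    by (auto simp: inv_surface_def)
  have "sol_translation c ` range (inv_param y z s) = range (inv_param y z s)" for s
  proof -
    have "sol_translation c \<circ> inv_param y z s = inv_param y z s \<circ> (\<lambda>t. t + c)"
      by (auto simp: sol_translation_def inv_param_def)
    moreover have "surj (\<lambda>t. t + c)"
      by (rule surjI[where f = "\<lambda>t. t - c"]) simp
    ultimately show ?thesis by (metis image_comp)
  qed
  then show ?thesis by (simp add: S image_UN)
qed

definition minimal_inv_surface ::
  "real set \<Rightarrow> (real \<Rightarrow> real) \<Rightarrow> (real \<Rightarrow> real) \<Rightarrow> (real \<Rightarrow> real) \<Rightarrow> bool" where
  "minimal_inv_surface I y z \<theta> \<longleftrightarrow>
     (\<forall>s\<in>I. \<forall>t. mean_curvature sol_metric (inv_param y z) (inv_normal y z \<theta>) s t = 0)"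

section \<open>The model surfaces\<close>

definition leaf_Q :: "real \<Rightarrow> (real^3) set" where
  "leaf_Q t = {vector [x, t, z] | x z. True}"

definition leaf_R :: "real \<Rightarrow> (real^3) set" where
  "leaf_R t = {vector [x, y, t] | x y. True}"

text \<open>The surface generated by the graph of \<open>f\<close> over \<open>D\<close>.\<close>

definition graph_surface :: "real set \<Rightarrow> (real \<Rightarrow> real) \<Rightarrow> (real^3) set" where
  "graph_surface D f = {vector [x, y, f y] | x y. y \<in> D}"

definition open_part_of :: "'a::topological_space set \<Rightarrow> 'a set \<Rightarrow> bool" where
  "open_part_of S M \<longleftrightarrow> openin (top_of_set M) S"

end

theory Submission
  imports Defs
begin

text \<open>
  The slices \<open>x = const\<close> of Sol carry the metric \<open>e\<^sup>-\<^sup>2\<^sup>z dy\<^sup>2 + dz\<^sup>2\<close>. In the coordinate \<open>w = e\<^sup>z\<close> this is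
  \<open>(dy\<^sup>2 + dw\<^sup>2) / w\<^sup>2\<close>, the upper half-plane model of the hyperbolic plane. The generating curve
  satisfies \<open>y' = w cos \<theta>\<close> and \<open>w' = w sin \<theta>\<close>, so \<open>\<theta>\<close> is the Euclidean angle of the curve in the
  half-plane.

  Both coordinate directions of the parametrization are principal. The rulings have principal
  curvature \<open>- cos \<theta>\<close>. Along the generating curve the principal curvature is its geodesic
  curvature in the hyperbolic slice, \<open>\<theta>' + cos \<theta>\<close>. The two cosines cancel in the sum, hence
  \<open>H = \<theta>' / 2\<close> (\<open>mean_curvature_inv\<close>), and the surface is minimal exactly when \<open>\<theta>\<close> is constant, that
  is, when the generating curve runs along a Euclidean straight line \<open>c w = a y + b\<close> of the
  half-plane.

  The three families are the three kinds of straight line. A vertical line \<open>y = t\<close> generates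
  a leaf \<open>Q\<^sub>t\<close>, a horizontal line \<open>w = e\<^sup>t\<close> a leaf \<open>R\<^sub>t\<close>, and an oblique line \<open>w = a y + b\<close> the graph
  \<open>z = log (a y + b)\<close>. From constant angle to a model surface (\<open>constant_angle_imp_model\<close>), the
  equation of the line is a first integral, and openness in the model holds because one of
  \<open>y\<close>, \<open>z\<close> is an affine function of arc length with nonzero slope. In the opposite direction
  (\<open>angle_stationary_on_line\<close>), differentiating the equation of the line twice yields
  \<open>\<theta>' = 0\<close>.
\<close>

section \<open>The Levi-Civita connection of Sol\<close>

lemma matrix_inv_eqI:
  fixes A :: "'a::semiring_1^'n^'n"
  assumes "A ** B = mat 1" and "B ** A = mat 1"
  shows "matrix_inv A = B"
proof -
  have "A ** matrix_inv A = mat 1 \<and> matrix_inv A ** A = mat 1"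
    unfolding matrix_inv_def by (rule someI[of _ B]) (simp add: assms)
  then have "matrix_inv A = B ** A ** matrix_inv A" and "B ** (A ** matrix_inv A) = B"
    using assms by (simp_all add: matrix_mul_lid matrix_mul_rid)
  then show ?thesis by (simp add: matrix_mul_assoc)
qed

lemma matrix_inv_sol_metric:
  "matrix_inv (sol_metric p) =
     vector [vector [exp (- 2 * p$3), 0, 0], vector [0, exp (2 * p$3), 0], vector [0, 0, 1]]"
  by (rule matrix_inv_eqI)
     (simp_all add: sol_metric_def matrix_matrix_mult_def mat_def vec_eq_iff forall_3 sum_3
       flip: exp_add)

text \<open>The coefficients of the Sol metric depend on \<open>z\<close> alone, so partial derivatives reduce to
  ordinary ones.\<close>

lemma coord_deriv_function_of_third:
  fixes \<phi> :: "real \<Rightarrow> real" and p :: "real^3"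
  assumes "(\<phi> has_real_derivative d) (at (p $ 3))"
  shows "coord_deriv i (\<lambda>q. \<phi> (q $ 3)) p = (if i = 3 then d else 0)"
proof (cases "i = 3")
  case True
  have "((\<lambda>h. \<phi> (p $ 3 + h)) has_real_derivative d) (at 0)"
    using assms DERIV_shift[of \<phi> d 0 "p $ 3"] by (simp add: add.commute)
  with True show ?thesis
    by (simp add: coord_deriv_def DERIV_imp_deriv)
next
  case False
  then show ?thesis by (simp add: coord_deriv_def axis_def)
qed

lemma coord_deriv_sol_metric:
  "coord_deriv l (\<lambda>q. sol_metric q $ i $ j) p =
     (if l = 3 \<and> i = 1 \<and> j = 1 then 2 * exp (2 * p$3)
      else if l = 3 \<and> i = 2 \<and> j = 2 then - 2 * exp (- 2 * p$3) else 0)"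
proof -
  have const: "coord_deriv l (\<lambda>q. k) p = 0" for l k and p :: "real^3"
    by (simp add: coord_deriv_def)
  have 1: "coord_deriv l (\<lambda>q. exp (2 * q$3)) p = (if l = 3 then 2 * exp (2 * p$3) else 0)"
    for l and p :: "real^3"
    by (rule coord_deriv_function_of_third[where \<phi> = "\<lambda>x. exp (2 * x)"])
       (auto intro!: derivative_eq_intros)
  have 2: "coord_deriv l (\<lambda>q. exp (- (2 * q$3))) p = (if l = 3 then - 2 * exp (- 2 * p$3) else 0)"
    for l and p :: "real^3"
    by (rule coord_deriv_function_of_third[where \<phi> = "\<lambda>x. exp (- (2 * x))"])
       (auto intro!: derivative_eq_intros)
  show ?thesis
    using exhaust_3[of i] exhaust_3[of j]
    by (auto simp: sol_metric_def 1 2 const)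
qed

lemma christoffel_sol:
  "christoffel sol_metric p k i j =
     (if k = 1 \<and> (i = 1 \<and> j = 3 \<or> i = 3 \<and> j = 1) then 1
      else if k = 2 \<and> (i = 2 \<and> j = 3 \<or> i = 3 \<and> j = 2) then - 1
      else if k = 3 \<and> i = 1 \<and> j = 1 then - exp (2 * p$3)
      else if k = 3 \<and> i = 2 \<and> j = 2 then exp (- 2 * p$3) else 0)"
proof -
  have "exp (- (2 * p$3)) * exp (2 * p$3) = 1"
    by (simp flip: exp_add)
  then show ?thesis
    using exhaust_3[of i] exhaust_3[of j] exhaust_3[of k]
    unfolding christoffel_def coord_deriv_sol_metric matrix_inv_sol_metric sum_3
    by (elim disjE) (simp_all add: mult.commute)
qed

text \<open>With the Christoffel symbols inserted, the covariant derivative needs only the velocity of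
  the curve and the derivative of the field; this is the form in which it is applied to the normal
  of an invariant surface.\<close>

lemma cov_deriv_sol:
  assumes "(c has_vector_derivative v) (at u)" and "(V has_vector_derivative w) (at u)"
  shows "cov_deriv sol_metric c V u =
    vector [w$1 + v$1 * V u$3 + v$3 * V u$1,
            w$2 - v$2 * V u$3 - v$3 * V u$2,
            w$3 - exp (2 * c u$3) * v$1 * V u$1 + exp (- 2 * c u$3) * v$2 * V u$2]"
  using assms[THEN vector_derivative_at]
  by (simp add: cov_deriv_def vec_eq_iff forall_3 sum_3 christoffel_sol)

section \<open>Curvature of invariant surfaces\<close>

lemma has_vector_derivative_vector_3:
  assumes "(f has_real_derivative f') (at x)" "(g has_real_derivative g') (at x)"
    "(h has_real_derivative h') (at x)"
  shows "((\<lambda>x. vector [f x, g x, h x] :: real^3) has_vector_derivative vector [f', g', h']) (at x)"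
proof -
  have frame: "vector [a, b, c] = a *\<^sub>R axis 1 1 + b *\<^sub>R axis 2 1 + c *\<^sub>R (axis 3 1 :: real^3)"
    for a b c :: real
    by (simp add: vec_eq_iff forall_3 axis_def)
  have "((\<lambda>x. a x *\<^sub>R v) has_vector_derivative a' *\<^sub>R v) (at x)"
    if "(a has_real_derivative a') (at x)" for a a' and v :: "real^3"
    using has_vector_derivative_scaleR[OF that has_vector_derivative_const] by simp
  from this[OF assms(1)] this[OF assms(2)] this[OF assms(3)] show ?thesis
    unfolding frame by (intro has_vector_derivative_add)
qed

lemma inv_param_derivs:
  shows "(y has_real_derivative y') (at s) \<Longrightarrow> (z has_real_derivative z') (at s) \<Longrightarrow>
      ((\<lambda>u. inv_param y z u t) has_vector_derivative vector [0, y', z']) (at s)"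
    and "(inv_param y z s has_vector_derivative vector [1, 0, 0]) (at t)"
  unfolding inv_param_def[abs_def]
  by (rule has_vector_derivative_vector_3; simp)+

lemma inv_normal_eq: "inv_normal y z \<theta> s t = vector [0, - exp (z s) * sin (\<theta> s), cos (\<theta> s)]"
  by (simp add: inv_normal_def inv_param_def sol_E2_def sol_E3_def vec_eq_iff forall_3)

text \<open>Weingarten equations: both coordinate directions are principal. Along the generating
  curve the terms \<open>sin\<^sup>2 \<theta>\<close> from differentiating \<open>e\<^sup>z\<close> cancel against Christoffel terms, leaving a
  multiple of the velocity. Along a ruling the normal has constant components, and only the
  Christoffel symbol with indices \<open>1, 1, 3\<close> contributes.\<close>

lemma shape_operator_inv:
  assumes y: "(y has_real_derivative exp (z s) * cos (\<theta> s)) (at s)"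
    and z: "(z has_real_derivative sin (\<theta> s)) (at s)"
    and th: "(\<theta> has_real_derivative k) (at s)"
  shows "cov_deriv sol_metric (\<lambda>u. inv_param y z u t) (\<lambda>u. inv_normal y z \<theta> u t) s =
           - (k + cos (\<theta> s)) *\<^sub>R vector [0, exp (z s) * cos (\<theta> s), sin (\<theta> s)]" (is ?A)
    and "cov_deriv sol_metric (inv_param y z s) (inv_normal y z \<theta> s) t =
           cos (\<theta> s) *\<^sub>R vector [1, 0, 0]" (is ?B)
proof -
  have N: "((\<lambda>u. inv_normal y z \<theta> u t) has_vector_derivative
     vector [0, - exp (z s) * (sin (\<theta> s) * sin (\<theta> s) + k * cos (\<theta> s)), - k * sin (\<theta> s)]) (at s)"
    unfolding inv_normal_eq
    by (rule has_vector_derivative_vector_3)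
       (auto intro!: derivative_eq_intros z th simp: algebra_simps)
  \<comment> \<open>In this form the identity rewrites the products that the simplifier leaves in the goal.\<close>
  have "exp (z s) * (exp (z s) * exp (- (z s * 2))) = 1"
    by (simp flip: exp_add)
  then show ?A
    unfolding cov_deriv_sol[OF inv_param_derivs(1)[OF y z] N]
    by (simp add: vec_eq_iff forall_3 inv_normal_eq inv_param_def algebra_simps)
  have N': "(inv_normal y z \<theta> s has_vector_derivative 0) (at t)"
    unfolding inv_normal_eq[abs_def] by simp
  show ?B
    unfolding cov_deriv_sol[OF inv_param_derivs(2) N']
    by (simp add: vec_eq_iff forall_3 inv_normal_eq)
qed

text \<open>The coordinate vectors are linearly independent, because sine and cosine have no common
  zero; hence the shape operator, diagonal in these vectors, has just the two diagonal entries as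
  eigenvalues.\<close>

lemma principal_curvatures_inv:
  assumes y: "(y has_real_derivative exp (z s) * cos (\<theta> s)) (at s)"
    and z: "(z has_real_derivative sin (\<theta> s)) (at s)"
    and th: "(\<theta> has_real_derivative k) (at s)"
  shows "principal_curvatures sol_metric (inv_param y z) (inv_normal y z \<theta>) s t =
           {- cos (\<theta> s), k + cos (\<theta> s)}"
proof -
  have nz: "cos (\<theta> s) \<noteq> 0 \<or> sin (\<theta> s) \<noteq> 0"
    by (auto dest!: sin_zero_abs_cos_one)
  have comp: "- (a *\<^sub>R (- (k + cos (\<theta> s)) *\<^sub>R vector [0, exp (z s) * cos (\<theta> s), sin (\<theta> s)])
         + b *\<^sub>R (cos (\<theta> s) *\<^sub>R vector [1, 0, 0 :: real]))
      = \<kappa> *\<^sub>R (a *\<^sub>R vector [0, exp (z s) * cos (\<theta> s), sin (\<theta> s)] + b *\<^sub>R (vector [1, 0, 0] :: real^3))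
      \<longleftrightarrow> a * (k + cos (\<theta> s) - \<kappa>) = 0 \<and> b * (cos (\<theta> s) + \<kappa>) = 0" (is "?L = ?R \<longleftrightarrow> ?E") for a b \<kappa>
  proof -
    have "?L = ?R \<longleftrightarrow> b * (cos (\<theta> s) + \<kappa>) = 0 \<and>
        (a * (k + cos (\<theta> s) - \<kappa>)) * (exp (z s) * cos (\<theta> s)) = 0 \<and>
        (a * (k + cos (\<theta> s) - \<kappa>)) * sin (\<theta> s) = 0"
      by (simp add: vec_eq_iff forall_3 algebra_simps)
    also have "\<dots> \<longleftrightarrow> ?E"
      using nz by auto
    finally show ?thesis .
  qed
  have "principal_curvatures sol_metric (inv_param y z) (inv_normal y z \<theta>) s t =
     {\<kappa>. \<exists>a b. (a, b) \<noteq> (0, 0) \<and> a * (k + cos (\<theta> s) - \<kappa>) = 0 \<and> b * (cos (\<theta> s) + \<kappa>) = 0}"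
    unfolding principal_curvatures_def shape_operator_inv[of y z s \<theta>, OF y z th] comp
      inv_param_derivs(1)[OF y z, THEN vector_derivative_at]
      inv_param_derivs(2)[THEN vector_derivative_at] by simp
  also have "\<dots> = {- cos (\<theta> s), k + cos (\<theta> s)}"
  proof (intro set_eqI iffI)
    fix \<kappa>
    assume "\<kappa> \<in> {- cos (\<theta> s), k + cos (\<theta> s)}"
    \<comment> \<open>The eigenvectors are \<open>X\<^sub>t\<close> for the first value and \<open>X\<^sub>s\<close> for the second.\<close>
    then have "(0::real, 1::real) \<noteq> (0, 0) \<and> 0 * (k + cos (\<theta> s) - \<kappa>) = 0 \<and> 1 * (cos (\<theta> s) + \<kappa>) = 0 \<or>
       (1::real, 0::real) \<noteq> (0, 0) \<and> 1 * (k + cos (\<theta> s) - \<kappa>) = 0 \<and> 0 * (cos (\<theta> s) + \<kappa>) = 0"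
      by auto
    then show "\<kappa> \<in> {\<kappa>. \<exists>a b. (a, b) \<noteq> (0, 0) \<and> a * (k + cos (\<theta> s) - \<kappa>) = 0 \<and> b * (cos (\<theta> s) + \<kappa>) = 0}"
      by blast
  qed (auto simp: eq_neg_iff_add_eq_0 add.commute)
  finally show ?thesis .
qed

text \<open>For two real numbers the largest and the smallest add up to their sum, also when they
  coincide; the summands \<open>cos \<theta>\<close> cancel.\<close>

lemma mean_curvature_inv:
  assumes "(y has_real_derivative exp (z s) * cos (\<theta> s)) (at s)"
    and "(z has_real_derivative sin (\<theta> s)) (at s)"
    and "(\<theta> has_real_derivative k) (at s)"
  shows "mean_curvature sol_metric (inv_param y z) (inv_normal y z \<theta>) s t = k / 2"
  by (simp add: mean_curvature_def principal_curvatures_inv[OF assms] max_def min_def)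

lemma minimal_iff_angle_stationary:
  assumes "generating_curve I y z \<theta>"
  shows "minimal_inv_surface I y z \<theta> \<longleftrightarrow> (\<forall>s\<in>I. (\<theta> has_real_derivative 0) (at s))"
proof -
  have "(\<forall>t. mean_curvature sol_metric (inv_param y z) (inv_normal y z \<theta>) s t = 0)
      \<longleftrightarrow> (\<theta> has_real_derivative 0) (at s)" if s: "s \<in> I" for s
  proof -
    have "\<theta> differentiable (at s)"
      using assms s by (auto simp: generating_curve_def smooth_on_open_def dest!: spec[of _ 0])
    then obtain k where k: "(\<theta> has_real_derivative k) (at s)"
      by (auto simp: real_differentiable_def)
    have "mean_curvature sol_metric (inv_param y z) (inv_normal y z \<theta>) s t = k / 2" for t
      by (rule mean_curvature_inv) (use assms s k in \<open>auto simp: generating_curve_def\<close>)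
    with k show ?thesis by (auto dest: DERIV_unique)
  qed
  then show ?thesis by (auto simp: minimal_inv_surface_def)
qed

section \<open>Curves of constant angle\<close>

lemma affine_of_constant_derivative:
  fixes f :: "real \<Rightarrow> real"
  assumes "is_interval I" and "r \<in> I" and "s \<in> I"
    and "\<And>u. u \<in> I \<Longrightarrow> (f has_real_derivative m) (at u)"
  shows "f s = m * s + (f r - m * r)"
proof -
  have "\<exists>c. \<forall>u\<in>I. f u - m * u = c"
  proof (rule has_field_derivative_zero_constant)
    show "convex I" using assms(1) by (simp add: is_interval_convex)
    show "((\<lambda>u. f u - m * u) has_real_derivative 0) (at u within I)" if "u \<in> I" for u
      by (rule DERIV_subset[of _ _ _ UNIV]) (auto intro!: derivative_eq_intros assms(4) that)
  qed
  then have "f s - m * s = f r - m * r"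
    using assms(2,3) by auto
  then show ?thesis by simp
qed

lemma open_image_of_constant_derivative:
  fixes f :: "real \<Rightarrow> real"
  assumes "open I" and "is_interval I" and "m \<noteq> 0"
    and "\<And>u. u \<in> I \<Longrightarrow> (f has_real_derivative m) (at u)"
  shows "open (f ` I)"
proof (cases "I = {}")
  case False
  then obtain r where r: "r \<in> I" by auto
  have "f ` I = (\<lambda>s. (f r - m * r) + m *\<^sub>R s) ` I"
    using affine_of_constant_derivative[OF assms(2) r _ assms(4)] by (force simp: image_iff)
  also have "open \<dots>" 
    using assms(1,3) by (rule open_affinity)
  finally show ?thesis .
qed simp

text \<open>The invariant surfaces in question are cut out of their model by restricting one coordinate
  to the values it takes on the generating curve.\<close>

lemma open_part_of_slab:
  fixes M :: "(real^'n) set"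
  assumes "open U" and "S = {p \<in> M. p $ i \<in> U}"
  shows "open_part_of S M"
proof -
  have "open ((\<lambda>p. p $ i) -` U :: (real^'n) set)"
    using assms(1) by (rule open_vimage) (intro continuous_intros)
  then have "openin (top_of_set M) (M \<inter> (\<lambda>p. p $ i) -` U)"
    by blast
  moreover have "S = M \<inter> (\<lambda>p. p $ i) -` U"
    using assms(2) by auto
  ultimately show ?thesis by (simp add: open_part_of_def)
qed

lemma mem_inv_surface: "p \<in> inv_surface I y z \<longleftrightarrow> (\<exists>s\<in>I. p $ 2 = y s \<and> p $ 3 = z s)"
  by (auto simp: inv_surface_def inv_param_def vec_eq_iff forall_3)

lemma mem_leaf_Q: "p \<in> leaf_Q t \<longleftrightarrow> p $ 2 = t"
  by (auto simp: leaf_Q_def vec_eq_iff forall_3)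

lemma mem_leaf_R: "p \<in> leaf_R t \<longleftrightarrow> p $ 3 = t"
  by (auto simp: leaf_R_def vec_eq_iff forall_3)

lemma mem_graph_surface: "p \<in> graph_surface D f \<longleftrightarrow> p $ 2 \<in> D \<and> p $ 3 = f (p $ 2)"
  by (auto simp: graph_surface_def vec_eq_iff forall_3)

text \<open>In the coordinate \<open>w = e\<^sup>z\<close> the logarithmic graph is the part of a plane with \<open>w > 0\<close>, and
  the domain condition is automatic there.\<close>

lemma mem_log_graph_surface:
  "p \<in> graph_surface {u. 0 < a * u + b} (\<lambda>u. ln (a * u + b)) \<longleftrightarrow> exp (p $ 3) = a * p $ 2 + b"
  by (auto simp: mem_graph_surface) (metis exp_gt_zero, metis ln_exp)

lemma curve_in_open_part:
  assumes "open_part_of (inv_surface I y z) M" and "s \<in> I"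
  shows "vector [0, y s, z s] \<in> M"
proof -
  have "inv_surface I y z \<subseteq> M"
    using assms(1) unfolding open_part_of_def by (auto dest: openin_imp_subset)
  moreover have "vector [0, y s, z s] \<in> inv_surface I y z"
    using assms(2) by (auto simp: mem_inv_surface)
  ultimately show ?thesis by blast
qed

text \<open>For constant angle \<open>\<theta>\<^sub>0\<close> the curve \<open>(y, w)\<close> with \<open>w = e\<^sup>z\<close> has direction \<open>(cos \<theta>\<^sub>0, sin \<theta>\<^sub>0)\<close>
  throughout, so \<open>cos \<theta>\<^sub>0 w - sin \<theta>\<^sub>0 y\<close> is a first integral. The cases of the proof are the horizontal,
  vertical and oblique lines.\<close>

lemma constant_angle_imp_model:
  assumes gc: "generating_curve I y z \<theta>" and th: "\<And>s. s \<in> I \<Longrightarrow> \<theta> s = \<theta>\<^sub>0"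
  shows "(\<exists>t. open_part_of (inv_surface I y z) (leaf_Q t)) \<or>
    (\<exists>t. open_part_of (inv_surface I y z) (leaf_R t)) \<or>
    (\<exists>a b. a \<noteq> 0 \<and>
       open_part_of (inv_surface I y z)
         (graph_surface {u. 0 < a * u + b} (\<lambda>u. ln (a * u + b))))"
proof -
  have I: "open I" "is_interval I" and "I \<noteq> {}"
    using gc by (auto simp: generating_curve_def)
  then obtain r where r: "r \<in> I" by auto
  have y': "(y has_real_derivative exp (z s) * cos \<theta>\<^sub>0) (at s)"
    and z': "(z has_real_derivative sin \<theta>\<^sub>0) (at s)" if "s \<in> I" for s
    using gc th that by (auto simp: generating_curve_def)
  obtain b where line: "cos \<theta>\<^sub>0 * exp (z s) = sin \<theta>\<^sub>0 * y s + b" if "s \<in> I" for s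
  proof
    fix s assume s: "s \<in> I"
    have "((\<lambda>u. cos \<theta>\<^sub>0 * exp (z u) - sin \<theta>\<^sub>0 * y u) has_real_derivative 0) (at u)" if "u \<in> I" for u
      by (auto intro!: derivative_eq_intros y'[OF that] z'[OF that])
    from affine_of_constant_derivative[OF I(2) r s this]
    show "cos \<theta>\<^sub>0 * exp (z s) = sin \<theta>\<^sub>0 * y s + (cos \<theta>\<^sub>0 * exp (z r) - sin \<theta>\<^sub>0 * y r)"
      by simp
  qed
  show ?thesis
  proof (cases "sin \<theta>\<^sub>0 = 0")
    case True
    then have "cos \<theta>\<^sub>0 \<noteq> 0"
      by (auto dest!: sin_zero_abs_cos_one)
    define h where "h = ln (b / cos \<theta>\<^sub>0)"
    have h: "z s = h" if "s \<in> I" for s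
    proof -
      have "b / cos \<theta>\<^sub>0 = exp (z s)"
        using line[OF that] True \<open>cos \<theta>\<^sub>0 \<noteq> 0\<close> by (simp add: field_simps)
      then show ?thesis by (simp add: h_def)
    qed
    have "(y has_real_derivative exp h * cos \<theta>\<^sub>0) (at s)" if "s \<in> I" for s
      using y'[OF that] h[OF that] by simp
    then have "open (y ` I)"
      using open_image_of_constant_derivative[OF I, of "exp h * cos \<theta>\<^sub>0" y] \<open>cos \<theta>\<^sub>0 \<noteq> 0\<close> by simp
    moreover have "inv_surface I y z = {p \<in> leaf_R h. p $ 2 \<in> y ` I}"
      using h by (auto simp: mem_inv_surface mem_leaf_R)
    ultimately show ?thesis
      using open_part_of_slab by blast
  next
    case False
    then have "open (z ` I)"
      using open_image_of_constant_derivative[OF I _ z'] by blast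
    show ?thesis
    proof (cases "cos \<theta>\<^sub>0 = 0")
      case True
      have "y s = - b / sin \<theta>\<^sub>0" if "s \<in> I" for s
        using line[OF that] True False by (simp add: field_simps)
      then have "inv_surface I y z = {p \<in> leaf_Q (- b / sin \<theta>\<^sub>0). p $ 3 \<in> z ` I}"
        by (auto simp: mem_inv_surface mem_leaf_Q)
      with \<open>open (z ` I)\<close> show ?thesis
        using open_part_of_slab by blast
    next
      case cos: False
      \<comment> \<open>Slope and intercept of the oblique line in the half-plane.\<close>
      define a d where "a = sin \<theta>\<^sub>0 / cos \<theta>\<^sub>0" and "d = b / cos \<theta>\<^sub>0"
      have "a \<noteq> 0" using cos False by (simp add: a_def)
      have eq: "exp (z s) = a * y s + d" if "s \<in> I" for s
        using line[OF that] cos by (simp add: a_def d_def field_simps)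
      have "inv_surface I y z =
          {p \<in> graph_surface {u. 0 < a * u + d} (\<lambda>u. ln (a * u + d)). p $ 3 \<in> z ` I}"
        using eq \<open>a \<noteq> 0\<close> by (auto simp: mem_inv_surface mem_log_graph_surface) metis
      with \<open>open (z ` I)\<close> show ?thesis
        using open_part_of_slab \<open>a \<noteq> 0\<close> by blast
    qed
  qed
qed

section \<open>Curves on a straight line of the half-plane\<close>

text \<open>The relation says that the unit vector \<open>(cos \<theta>, sin \<theta>)\<close> stays parallel to \<open>(c, a)\<close>. Its
  derivative is \<open>\<theta>'\<close> times \<open>c cos \<theta> + a sin \<theta>\<close>, the component along \<open>(c, a)\<close>, which cannot vanish at
  the same time as the perpendicular component.\<close>

lemma angle_stationary_of_linear_relation:
  fixes \<theta> :: "real \<Rightarrow> real"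
  assumes "open I" and "s \<in> I" and "\<theta> differentiable (at s)" and "(a, c) \<noteq> (0, 0)"
    and lin: "\<And>u. u \<in> I \<Longrightarrow> c * sin (\<theta> u) = a * cos (\<theta> u)"
  shows "(\<theta> has_real_derivative 0) (at s)"
proof -
  obtain k where k: "(\<theta> has_real_derivative k) (at s)"
    using assms(3) by (auto simp: real_differentiable_def)
  have "((\<lambda>u. c * sin (\<theta> u) - a * cos (\<theta> u)) has_real_derivative
      k * (c * cos (\<theta> s) + a * sin (\<theta> s))) (at s)"
    by (auto intro!: derivative_eq_intros k simp: algebra_simps)
  moreover have "((\<lambda>u. c * sin (\<theta> u) - a * cos (\<theta> u)) has_real_derivative 0) (at s)"
    by (rule has_field_derivative_transform_within_open[OF DERIV_const[of 0]])
       (use assms in auto)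
  ultimately have "k * (c * cos (\<theta> s) + a * sin (\<theta> s)) = 0"
    by (rule DERIV_unique)
  moreover have "c * cos (\<theta> s) + a * sin (\<theta> s) \<noteq> 0"
  proof
    assume "c * cos (\<theta> s) + a * sin (\<theta> s) = 0"
    then have "(c * cos (\<theta> s) + a * sin (\<theta> s))\<^sup>2 + (c * sin (\<theta> s) - a * cos (\<theta> s))\<^sup>2 = 0"
      using lin[OF assms(2)] by simp
    also have "(c * cos (\<theta> s) + a * sin (\<theta> s))\<^sup>2 + (c * sin (\<theta> s) - a * cos (\<theta> s))\<^sup>2 =
        (a\<^sup>2 + c\<^sup>2) * ((sin (\<theta> s))\<^sup>2 + (cos (\<theta> s))\<^sup>2)"
      by algebra
    finally show False
      using assms(4) by (simp add: sum_power2_eq_zero_iff)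
  qed
  ultimately show ?thesis using k by simp
qed

text \<open>Differentiating the equation of a straight line in the half-plane, with \<open>w' = w sin \<theta>\<close> and
  \<open>y' = w cos \<theta>\<close>, turns it into a linear relation between sine and cosine of the angle.\<close>

lemma angle_stationary_on_line:
  assumes gc: "generating_curve I y z \<theta>" and ac: "(a, c) \<noteq> (0, 0)"
    and line: "\<And>u. u \<in> I \<Longrightarrow> c * exp (z u) = a * y u + b" and s: "s \<in> I"
  shows "(\<theta> has_real_derivative 0) (at s)"
proof (rule angle_stationary_of_linear_relation[OF _ s _ ac])
  show "open I" and "\<theta> differentiable (at s)"
    using gc s by (auto simp: generating_curve_def smooth_on_open_def dest!: spec[of _ 0])
  fix u assume u: "u \<in> I"
  have "((\<lambda>u. c * exp (z u) - a * y u) has_real_derivative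
      exp (z u) * (c * sin (\<theta> u) - a * cos (\<theta> u))) (at u)"
    using gc u by (auto intro!: derivative_eq_intros simp: generating_curve_def algebra_simps)
  moreover have "((\<lambda>u. c * exp (z u) - a * y u) has_real_derivative 0) (at u)"
    by (rule has_field_derivative_transform_within_open[OF DERIV_const[of b] \<open>open I\<close> u])
       (simp add: line)
  ultimately have "exp (z u) * (c * sin (\<theta> u) - a * cos (\<theta> u)) = 0"
    by (rule DERIV_unique)
  then show "c * sin (\<theta> u) = a * cos (\<theta> u)" by simp
qed

section \<open>Classification of the minimal invariant surfaces\<close>

theorem theorem3p1:
  fixes I :: "real set" and y z \<theta> :: "real \<Rightarrow> real"
  assumes "generating_curve I y z \<theta>"
  shows "minimal_inv_surface I y z \<theta> \<longleftrightarrow>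
    (\<exists>t. open_part_of (inv_surface I y z) (leaf_Q t)) \<or>
    (\<exists>t. open_part_of (inv_surface I y z) (leaf_R t)) \<or>
    (\<exists>a b. a \<noteq> 0 \<and>
       open_part_of (inv_surface I y z)
         (graph_surface {u. 0 < a * u + b} (\<lambda>u. ln (a * u + b))))"
  (is "_ \<longleftrightarrow> ?model")
proof
  assume "minimal_inv_surface I y z \<theta>"
  then have th': "(\<theta> has_real_derivative 0) (at s)" if "s \<in> I" for s
    using minimal_iff_angle_stationary[OF assms] that by blast
  have I: "is_interval I" and "I \<noteq> {}"
    using assms by (auto simp: generating_curve_def)
  then obtain r where r: "r \<in> I" by auto
  have "\<theta> s = \<theta> r" if "s \<in> I" for s
    using affine_of_constant_derivative[OF I r that th'] by simp
  with assms show ?model by (rule constant_angle_imp_model)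
next
  assume ?model
  then consider (Q) t where "open_part_of (inv_surface I y z) (leaf_Q t)"
    | (R) t where "open_part_of (inv_surface I y z) (leaf_R t)"
    | (G) a b where "open_part_of (inv_surface I y z)
         (graph_surface {u. 0 < a * u + b} (\<lambda>u. ln (a * u + b)))"
    by blast
  \<comment> \<open>Each model surface lies over a straight line of the half-plane: vertical, horizontal, oblique.\<close>
  then have "\<exists>a c b. (a, c) \<noteq> (0, 0) \<and> (\<forall>s\<in>I. c * exp (z s) = a * y s + b)"
  proof cases
    case Q
    have "\<forall>s\<in>I. 0 * exp (z s) = 1 * y s + - t"
      using curve_in_open_part[OF Q] by (simp add: mem_leaf_Q)
    then show ?thesis by (metis prod.inject zero_neq_one)
  next
    case R
    have "\<forall>s\<in>I. 1 * exp (z s) = 0 * y s + exp t"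
      using curve_in_open_part[OF R] by (simp add: mem_leaf_R)
    then show ?thesis by (metis prod.inject zero_neq_one)
  next
    case G
    have "\<forall>s\<in>I. 1 * exp (z s) = a * y s + b"
      using curve_in_open_part[OF G] by (simp add: mem_log_graph_surface)
    then show ?thesis by (metis prod.inject zero_neq_one)
  qed
  then obtain a c b where ac: "(a, c) \<noteq> (0, 0)"
    and line: "\<And>s. s \<in> I \<Longrightarrow> c * exp (z s) = a * y s + b" by blast
  show "minimal_inv_surface I y z \<theta>"
    using minimal_iff_angle_stationary[OF assms] angle_stationary_on_line[OF assms ac line] by blast
qed

end
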